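(* Let $A,\hat A\in\mathbb{C}^{n\times n}$ be positive-semidefinite matrices with Kaporin condition number $\kappa_{\rm Kap}$, and let $b,x_0\in\mathbb{C}^n$. Let $x_\star=A^+b$ be the minimum-norm solution to $\min_x\lVert Ax-b\rVert^2$, and assume $\lVert x_0-x_\star\rVert_A\neq 0$. If $\hat A$ is normalized so that $\operatorname{tr}(A\hat A^+)=\operatorname{rank}(A)$, then $\hat x=x_0+\hat A^+[b-Ax_0]$ satisfies $$\frac{\lVert\hat x-x_\star\rVert_A^2}{\lVert x_0-x_\star\rVert_A^2}\le 2\operatorname{rank}(A)\log(\kappa_{\rm Kap}).$$
   Context: Positive-semidefinite matrices are Hermitian; $M^+$ is the Moore–Penrose pseudoinverse, and $\lVert x\rVert_A=(x^*Ax)^{1/2}$. $\operatorname{vol}(M)$ is the product of the positive eigenvalues of $M$ (with multiplicity). Kaporin condition number: if $A$ and $\hat A$ have the same range and $r=\operatorname{rank}(A)$, $$\kappa_{\rm Kap}=\frac{\bigl(\frac1r\operatorname{tr}(A\hat A^+)\bigr)^r}{\operatorname{vol}(A\hat A^+)};$$ if $A$ and $\hat A$ have different ranges, $\kappa_{\rm Kap}=\infty$ (and then the bound is vacuous, with $\log\infty=\infty$). *)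

theory Defs
  imports
    "HOL-Library.Extended_Real"
    "Jordan_Normal_Form.DL_Rank"
    "Jordan_Normal_Form.Schur_Decomposition"
begin

definition mat_rank :: "complex mat \<Rightarrow> nat" where
  "mat_rank A = vec_space.rank (dim_row A) A"

definition mat_range :: "complex mat \<Rightarrow> complex vec set" where
  "mat_range A = {A *\<^sub>v x | x. x \<in> carrier_vec (dim_col A)}"

definition mat_trace :: "complex mat \<Rightarrow> complex" where
  "mat_trace A = (\<Sum>i<dim_row A. A $$ (i, i))"

definition hermitian_mat :: "complex mat \<Rightarrow> bool" where
  "hermitian_mat A \<longleftrightarrow> mat_adjoint A = A"

text \<open>The library writes \<open>x \<bullet>c y\<close> for the inner product that is conjugate-linear in its
  second argument, so \<open>(A *\<^sub>v x) \<bullet>c x\<close> is the quadratic form of \<open>A\<close> at \<open>x\<close>. It is real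
  for Hermitian \<open>A\<close>.\<close>

definition quad_form :: "complex mat \<Rightarrow> complex vec \<Rightarrow> real" where
  "quad_form A x = Re ((A *\<^sub>v x) \<bullet>c x)"

definition psd_mat :: "nat \<Rightarrow> complex mat \<Rightarrow> bool" where
  "psd_mat n A \<longleftrightarrow> A \<in> carrier_mat n n \<and> hermitian_mat A \<and>
     (\<forall>x \<in> carrier_vec n. quad_form A x \<ge> 0)"

definition norm_mat :: "complex mat \<Rightarrow> complex vec \<Rightarrow> real" where
  "norm_mat A x = sqrt (quad_form A x)"

text \<open>The four Penrose conditions, which have exactly one solution for every complex matrix.\<close>

definition is_pinv :: "complex mat \<Rightarrow> complex mat \<Rightarrow> bool" where
  "is_pinv A X \<longleftrightarrow> X \<in> carrier_mat (dim_col A) (dim_row A) \<and>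
     A * X * A = A \<and> X * A * X = X \<and> hermitian_mat (A * X) \<and> hermitian_mat (X * A)"

definition pinv :: "complex mat \<Rightarrow> complex mat" where
  "pinv A = (THE X. is_pinv A X)"

text \<open>The product of the positive eigenvalues of \<open>M\<close>, each taken with its algebraic
  multiplicity. \<open>M\<close> need not be Hermitian: the definition is applied to products of two
  positive-semidefinite matrices.\<close>

definition mat_vol :: "complex mat \<Rightarrow> real" where
  "mat_vol M = (\<Prod>t \<in> {t. t > 0 \<and> eigenvalue M (complex_of_real t)}.
     t ^ order (complex_of_real t) (char_poly M))"

text \<open>The trace of \<open>A * pinv B\<close> is real when \<open>A\<close> and \<open>B\<close> are positive-semidefinite, so taking
  its real part loses nothing there.\<close>

definition kaporin :: "complex mat \<Rightarrow> complex mat \<Rightarrow> ereal" where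
  "kaporin A B =
     (if mat_range A = mat_range B
      then ereal ((1 / real (mat_rank A) * Re (mat_trace (A * pinv B))) ^ mat_rank A
                  / mat_vol (A * pinv B))
      else \<infinity>)"

definition ln_ereal :: "ereal \<Rightarrow> ereal" where
  "ln_ereal x = (if x = \<infinity> then \<infinity> else if x \<le> 0 then -\<infinity> else ereal (ln (real_of_ereal x)))"

end

theory Submission
  imports Defs
begin

text \<open>The Kaporin number controls one preconditioned step through the spectrum of
  \<open>A * pinv A'\<close>. Suppose the ranges of \<open>A\<close> and \<open>A'\<close> agree (otherwise the right-hand side is
  infinite), let \<open>C\<close> be a Hermitian square root of \<open>A\<close>, and put \<open>H = C * (pinv A' * C)\<close>. This
  matrix is positive-semidefinite with the same range as \<open>A\<close> (\<open>symmetrized_product\<close>), and it has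
  the same characteristic polynomial as \<open>A * pinv A' = C * (C * pinv A')\<close>, from which it arises by
  exchanging two factors (\<open>char_poly_mult_commute\<close>). So \<open>A * pinv A'\<close> has exactly
  \<open>r = mat_rank A\<close> nonzero eigenvalues \<open>t 1, \<dots>, t r\<close>, all positive. The normalization makes
  their sum equal to \<open>r\<close>, and \<open>mat_vol (A * pinv A')\<close> is their product, so the logarithm of
  the Kaporin number is \<open>- ln (\<Prod>i. t i) = (\<Sum>i. t i - 1 - ln (t i))\<close>, a sum of nonnegative gaps.

  The error \<open>e = x0 - xs\<close> is mapped to \<open>e - pinv A' *\<^sub>v (A *\<^sub>v e)\<close> (\<open>step_error\<close>). Multiplied
  by \<open>C\<close>, which turns the \<open>A\<close>-norm into the Euclidean norm, this is the map sending
  \<open>y = C *\<^sub>v e\<close> to \<open>y - H *\<^sub>v y\<close>. Since \<open>y\<close> lies in the range of \<open>H\<close>, it has no component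
  along the kernel of \<open>H\<close>, where the factor would be 1. So the squared norm is multiplied
  by at most the largest \<open>(1 - t i)\<^sup>2\<close>.

  It remains to bound \<open>(1 - t)\<^sup>2\<close> by the gap \<open>t - 1 - ln t\<close>. Because the \<open>t i\<close> are positive
  with sum \<open>r\<close>, each is at most \<open>r\<close>, and on \<open>(0, r]\<close> the inequality
  \<open>(1 - t)\<^sup>2 \<le> 2 * r * (t - 1 - ln t)\<close> holds (\<open>square_le_ln_gap\<close>). One gap is at most the sum of
  all of them, which gives the constant \<open>2 * r\<close>.

  Both \<open>C\<close> and the eigenvalues \<open>t i\<close> come from the spectral theorem for Hermitian matrices,
  proved here by unitary deflation (\<open>spectral_theorem\<close>).\<close>

section \<open>The gap between a number and its logarithm\<close>

text \<open>The function \<open>t - 1 - ln t\<close> and its first derivative vanish at 1. Below 1 it dominates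
  \<open>(1 - t)\<^sup>2 / 2\<close>; above 1 its logarithmic growth only leaves \<open>(1 - t)\<^sup>2 / (2 * t)\<close>, which is
  where the bound \<open>R\<close> on \<open>t\<close> enters. Each comparison follows from the sign of the derivative
  of the difference, which is zero at 1.\<close>
lemma square_le_ln_gap:
  fixes t R :: real
  assumes "0 < t" "t \<le> R" "1 \<le> R"
  shows "(1 - t)\<^sup>2 \<le> 2 * R * (t - 1 - ln t)"
proof (cases "t \<le> 1")
  case True
  have "1 - 1 - ln 1 - (1 - 1)\<^sup>2 / 2 \<le> t - 1 - ln t - (1 - t)\<^sup>2 / 2"
  proof (rule DERIV_nonpos_imp_nonincreasing[OF True])
    fix x assume x: "t \<le> x" "x \<le> 1"
    then have "x > 0" using assms by simp
    then have "((\<lambda>t. t - 1 - ln t - (1 - t)\<^sup>2 / 2) has_real_derivative (1 - 1 / x + (1 - x))) (at x)"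
      by (auto intro!: derivative_eq_intros simp: field_simps)
    moreover have "1 - 1 / x + (1 - x) \<le> 0"
    proof -
      have "1 - 1 / x + (1 - x) = - ((1 - x)\<^sup>2 / x)"
        using \<open>x > 0\<close> by (simp add: field_simps power2_eq_square)
      then show ?thesis using \<open>x > 0\<close> by simp
    qed
    ultimately show "\<exists>y. ((\<lambda>t. t - 1 - ln t - (1 - t)\<^sup>2 / 2) has_real_derivative y) (at x) \<and> y \<le> 0"
      by blast
  qed
  then have h: "(1 - t)\<^sup>2 \<le> 2 * (t - 1 - ln t)" by simp
  moreover have "0 \<le> t - 1 - ln t" using ln_le_minus_one[OF assms(1)] by simp
  then have "2 * (t - 1 - ln t) \<le> 2 * R * (t - 1 - ln t)" using assms
    by (intro mult_right_mono) auto
  ultimately show ?thesis by linarith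
next
  case False
  then have t: "1 \<le> t" by simp
  have "1 - 1 - ln 1 - (1 - 1)\<^sup>2 / (2 * 1) \<le> t - 1 - ln t - (1 - t)\<^sup>2 / (2 * t)"
  proof (rule DERIV_nonneg_imp_nondecreasing[OF t])
    fix x assume x: "1 \<le> x" "x \<le> t"
    then have "x > 0" by simp
    then have "((\<lambda>t. t - 1 - ln t - (1 - t)\<^sup>2 / (2 * t)) has_real_derivative ((1 - x)\<^sup>2 / (2 * x\<^sup>2))) (at x)"
      by (auto intro!: derivative_eq_intros simp: field_simps power2_eq_square)
    moreover have "(1 - x)\<^sup>2 / (2 * x\<^sup>2) \<ge> 0" by simp
    ultimately show "\<exists>y. ((\<lambda>t. t - 1 - ln t - (1 - t)\<^sup>2 / (2 * t)) has_real_derivative y) (at x) \<and> 0 \<le> y"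
      by blast
  qed
  then have "(1 - t)\<^sup>2 / (2 * t) \<le> t - 1 - ln t" by simp
  then have h: "(1 - t)\<^sup>2 \<le> 2 * t * (t - 1 - ln t)" using t by (simp add: field_simps)
  moreover have "0 \<le> t - 1 - ln t" using ln_le_minus_one[OF assms(1)] by simp
  then have "2 * t * (t - 1 - ln t) \<le> 2 * R * (t - 1 - ln t)" using assms
    by (intro mult_right_mono) auto
  ultimately show ?thesis by linarith
qed

text \<open>Since the \<open>t i\<close> average to 1, the logarithm of their product is minus the sum of all gaps,
  and each \<open>t i\<close> is at most the number of terms.\<close>
lemma square_deviation_le_ln_prod:
  fixes t :: "'a \<Rightarrow> real"
  assumes fin: "finite I" and pos: "\<And>i. i \<in> I \<Longrightarrow> t i > 0"
    and sum: "sum t I = card I" and j: "j \<in> I"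
  shows "(1 - t j)\<^sup>2 \<le> 2 * real (card I) * - ln (prod t I)"
proof -
  have gap: "0 \<le> t i - 1 - ln (t i)" if "i \<in> I" for i
    using ln_le_minus_one[OF pos[OF that]] by simp
  have "t j \<le> card I"
    using member_le_sum[OF j, of t] fin pos sum by (simp add: less_imp_le)
  moreover have "0 < card I" using fin j by (auto simp: card_gt_0_iff)
  then have "1 \<le> real (card I)" by simp
  ultimately have "(1 - t j)\<^sup>2 \<le> 2 * real (card I) * (t j - 1 - ln (t j))"
    by (intro square_le_ln_gap pos j)
  also have "t j - 1 - ln (t j) \<le> (\<Sum>i\<in>I. t i - 1 - ln (t i))"
    using j gap fin by (intro member_le_sum) auto
  also have "(\<Sum>i\<in>I. t i - 1 - ln (t i)) = - ln (prod t I)"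
    using sum ln_prod[OF fin, of t] pos by (fastforce simp: sum_subtractf)
  finally show ?thesis by (simp add: mult_left_mono)
qed

section \<open>Adjoints and unitary matrices\<close>

lemma square_mult_carrier [simp]:
  "A \<in> carrier_mat n n \<Longrightarrow> B \<in> carrier_mat n n \<Longrightarrow> A * B \<in> carrier_mat n n"
  by (rule mult_carrier_mat)

lemma square_mult_vec_carrier [simp]:
  "A \<in> carrier_mat n n \<Longrightarrow> x \<in> carrier_vec n \<Longrightarrow> A *\<^sub>v x \<in> carrier_vec n"
  by (rule mult_mat_vec_carrier)

lemma mat_adjoint_dim [simp]:
  "dim_row (mat_adjoint A) = dim_col A" "dim_col (mat_adjoint A) = dim_row A"
  by (auto simp: mat_adjoint_def)

lemma mat_adjoint_carrier [simp]:
  "A \<in> carrier_mat m n \<Longrightarrow> mat_adjoint A \<in> carrier_mat n m"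
  by (intro carrier_matI) auto

lemma mat_adjoint_index [simp]:
  assumes "i < dim_col A" "j < dim_row A"
  shows "mat_adjoint A $$ (i, j) = conjugate (A $$ (j, i))"
  using assms by (simp add: mat_adjoint_def mat_of_rows_def)

lemma mat_adjoint_adjoint [simp]: "mat_adjoint (mat_adjoint A) = A"
  by (rule eq_matI) auto

lemma mat_adjoint_mult:
  fixes A B :: "complex mat"
  assumes "A \<in> carrier_mat l m" "B \<in> carrier_mat m n"
  shows "mat_adjoint (A * B) = mat_adjoint B * mat_adjoint A"
  using assms
  by (intro eq_matI) (auto simp: scalar_prod_def sum_conjugate conjugate_dist_mul mult.commute)

lemma cscalar_prod_adjoint:
  fixes M :: "complex mat"
  assumes "M \<in> carrier_mat m n" "x \<in> carrier_vec n" "y \<in> carrier_vec m"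
  shows "(M *\<^sub>v x) \<bullet>c y = x \<bullet>c (mat_adjoint M *\<^sub>v y)"
proof -
  have "(M *\<^sub>v x) \<bullet>c y = (\<Sum>i<m. \<Sum>j<n. M $$ (i,j) * x $ j * cnj (y $ i))"
    using assms by (auto simp: scalar_prod_def sum_distrib_right lessThan_atLeast0)
  also have "\<dots> = (\<Sum>j<n. \<Sum>i<m. M $$ (i,j) * x $ j * cnj (y $ i))"
    by (rule sum.swap)
  also have "\<dots> = x \<bullet>c (mat_adjoint M *\<^sub>v y)"
    using assms
    by (auto simp: scalar_prod_def sum_distrib_left lessThan_atLeast0 mult_ac intro!: sum.cong)
  finally show ?thesis .
qed

lemma cscalar_prod_self:
  fixes x :: "complex vec"
  shows "x \<bullet>c x = complex_of_real (\<Sum>i<dim_vec x. (cmod (x $ i))\<^sup>2)"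
  by (auto simp: scalar_prod_def lessThan_atLeast0 complex_norm_square simp del: of_real_power)

definition unitary_mat :: "nat \<Rightarrow> complex mat \<Rightarrow> bool" where
  "unitary_mat n U \<longleftrightarrow> U \<in> carrier_mat n n \<and> mat_adjoint U * U = 1\<^sub>m n \<and> U * mat_adjoint U = 1\<^sub>m n"

lemma unitary_matI:
  assumes "U \<in> carrier_mat n n" "mat_adjoint U * U = 1\<^sub>m n"
  shows "unitary_mat n U"
  using mat_mult_left_right_inverse[of "mat_adjoint U" n U] assms by (simp add: unitary_mat_def)

lemma unitary_mat_mult:
  assumes "unitary_mat n U" "unitary_mat n V"
  shows "unitary_mat n (U * V)"
proof (rule unitary_matI)
  have c: "U \<in> carrier_mat n n" "V \<in> carrier_mat n n"
    using assms by (auto simp: unitary_mat_def)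
  have "mat_adjoint (U * V) * (U * V) = mat_adjoint V * ((mat_adjoint U * U) * V)"
    using c by (simp add: mat_adjoint_mult[of _ n n _ n] assoc_mult_mat[of _ n n _ n _ n])
  then show "mat_adjoint (U * V) * (U * V) = 1\<^sub>m n"
    using assms c by (simp add: unitary_mat_def)
  show "U * V \<in> carrier_mat n n" using c by simp
qed

text \<open>Gram--Schmidt applied to a basis that starts with \<open>v\<close> keeps \<open>v\<close> in first position and makes
  the basis orthogonal; dividing each vector by its length gives the columns.\<close>
lemma unitary_mat_with_first_column:
  assumes v: "v \<in> carrier_vec n" and v0: "v \<noteq> 0\<^sub>v n"
  obtains U c where "unitary_mat n U" "col U 0 = c \<cdot>\<^sub>v v" "n > 0"
proof -
  have n: "n > 0" using v v0 by (cases n) auto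
  interpret cof_vec_space n "TYPE(complex)" .
  define b where "b = basis_completion v"
  define ws where "ws = gram_schmidt n b"
  from basis_completion[OF v v0, folded b_def]
  have dist_b: "distinct b" and indep: "\<not> lin_dep (set b)" and b: "set b \<subseteq> carrier_vec n"
    and hdb: "hd b = v" and len_b: "length b = n" by auto
  obtain vs where bv: "b = v # vs" using hdb len_b n by (cases b) auto
  from gram_schmidt_result[OF b dist_b indep refl, folded ws_def]
  have ws: "set ws \<subseteq> carrier_vec n" "corthogonal ws" "length ws = n"
    by (auto simp: len_b)
  have "ws \<noteq> []" using ws(3) n by auto
  then have hdws: "ws ! 0 = v"
    using gram_schmidt_hd[OF v, of vs, folded bv] by (metis hd_conv_nth ws_def)
  have wsc: "ws ! i \<in> carrier_vec n" if "i < n" for i using ws that by auto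
  define nr where "nr w = sqrt (Re (w \<bullet>c w))" for w :: "complex vec"
  define c where "c w = complex_of_real (1 / nr w)" for w
  define U where "U = mat n n (\<lambda>(i,j). c (ws ! j) * (ws ! j) $ i)"
  have Uc: "U \<in> carrier_mat n n" by (simp add: U_def)
  have colU: "col U j = c (ws ! j) \<cdot>\<^sub>v ws ! j" if "j < n" for j
    using that wsc[OF that] by (auto simp: U_def)
  have nr1: "c w * c w * (w \<bullet>c w) = 1" if "w \<bullet>c w \<noteq> 0" for w
  proof -
    define s where "s = (\<Sum>i<dim_vec w. (cmod (w $ i))\<^sup>2)"
    have s: "w \<bullet>c w = complex_of_real s" unfolding s_def by (rule cscalar_prod_self)
    have "s \<ge> 0" unfolding s_def by (simp add: sum_nonneg)
    moreover have "s \<noteq> 0" using that s by simp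
    ultimately have "1 / sqrt s * (1 / sqrt s) * s = 1" by simp
    then show ?thesis unfolding c_def nr_def s by (simp flip: of_real_mult)
  qed
  have "mat_adjoint U * U = 1\<^sub>m n"
  proof (rule eq_matI)
    fix i j assume ij: "i < dim_row (1\<^sub>m n :: complex mat)" "j < dim_col (1\<^sub>m n :: complex mat)"
    then have i: "i < n" and j: "j < n" by auto
    have "(mat_adjoint U * U) $$ (i, j) = col U j \<bullet>c col U i"
      using i j Uc by (auto simp: scalar_prod_def mult.commute intro!: sum.cong)
    also have "\<dots> = c (ws ! j) * c (ws ! i) * (ws ! j \<bullet>c ws ! i)"
      using wsc[OF i] wsc[OF j] by (simp add: colU i j conjugate_smult_vec c_def)
    also have "\<dots> = (if i = j then 1 else 0)"
      using corthogonalD[OF ws(2), of j i] nr1[of "ws ! i"] i j ws(3) by auto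
    finally show "(mat_adjoint U * U) $$ (i, j) = 1\<^sub>m n $$ (i, j)" using i j by simp
  qed (use Uc in auto)
  then have "unitary_mat n U" using Uc by (rule unitary_matI[rotated])
  then show thesis using that colU[OF n] n hdws by simp
qed

section \<open>The spectral theorem for Hermitian matrices\<close>

lemma hermitian_index:
  assumes "hermitian_mat A" "i < dim_row A" "j < dim_row A"
  shows "A $$ (i,j) = cnj (A $$ (j,i))"
  using assms mat_adjoint_index[of i A j] mat_adjoint_dim[of A]
  by (metis conjugate_complex_def hermitian_mat_def)

text \<open>Deflation: in a unitary basis whose first vector is an eigenvector, the first column of the
  Hermitian matrix is a multiple of the first unit vector, hence so is the first row. The
  remaining block is Hermitian and one size smaller.\<close>
lemma spectral_theorem:
  assumes "A \<in> carrier_mat n n" "hermitian_mat A"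
  shows "\<exists>U d. unitary_mat n U \<and>
    A = U * mat_diag n (\<lambda>i. complex_of_real (d i)) * mat_adjoint U"
  using assms
proof (induction n arbitrary: A)
  case 0
  then show ?case
    by (intro exI[of _ "1\<^sub>m 0"]) (auto simp: unitary_mat_def intro!: eq_matI)
next
  case (Suc n A)
  note A = Suc.prems(1) and hA = Suc.prems(2)
  let ?N = "Suc n"
  \<comment> \<open>The characteristic polynomial has positive degree, so it has a complex root.\<close>
  obtain e v where ev: "eigenvector A v e"
  proof -
    obtain as where as: "char_poly A = (\<Prod>a\<leftarrow>as. [:- a, 1:])" "length as = ?N"
      using char_poly_factorized[OF A] by auto
    then obtain e es where "as = e # es" by (cases as) auto
    then have "poly (char_poly A) e = 0" using as by simp
    then show ?thesis using eigenvalue_root_char_poly[OF A] that by (auto simp: eigenvalue_def)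
  qed
  then have v: "v \<in> carrier_vec ?N" "v \<noteq> 0\<^sub>v ?N" "A *\<^sub>v v = e \<cdot>\<^sub>v v"
    using A by (auto simp: eigenvector_def)
  obtain W c where W: "unitary_mat ?N W" "col W 0 = c \<cdot>\<^sub>v v"
    using unitary_mat_with_first_column[OF v(1,2)] by metis
  have Wc: "W \<in> carrier_mat ?N ?N" and W1: "mat_adjoint W * W = 1\<^sub>m ?N" "W * mat_adjoint W = 1\<^sub>m ?N"
    using W by (auto simp: unitary_mat_def)
  define M where "M = mat_adjoint W * A * W"
  have Mc: "M \<in> carrier_mat ?N ?N" using Wc A by (simp add: M_def)
  have hM: "hermitian_mat M"
    using hA Wc A unfolding hermitian_mat_def M_def
    by (simp add: mat_adjoint_mult[of _ ?N ?N _ ?N] assoc_mult_mat[of _ ?N ?N _ ?N _ ?N])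
  have AM: "A = W * M * mat_adjoint W"
  proof -
    have "W * M * mat_adjoint W = (W * mat_adjoint W) * A * (W * mat_adjoint W)"
      using Wc A unfolding M_def by (simp add: assoc_mult_mat[of _ ?N ?N _ ?N _ ?N])
    then show ?thesis using W1 A by simp
  qed
  have "col M 0 = mat_adjoint W *\<^sub>v (A *\<^sub>v col W 0)"
    using Wc A unfolding M_def
    by (simp only: assoc_mult_mat[of _ ?N ?N _ ?N _ ?N] mat_adjoint_carrier square_mult_carrier
        col_mult2[of _ ?N ?N _ ?N 0] zero_less_Suc)
  also have "\<dots> = mat_adjoint W *\<^sub>v (e \<cdot>\<^sub>v col W 0)"
    using v A W(2) by (simp add: mult_mat_vec[of _ ?N ?N] smult_smult_assoc mult.commute)
  also have "\<dots> = e \<cdot>\<^sub>v (mat_adjoint W *\<^sub>v col W 0)"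
    using Wc by (intro mult_mat_vec[of _ ?N ?N] carrier_vecI) auto
  also have "mat_adjoint W *\<^sub>v col W 0 = col (mat_adjoint W * W) 0"
    using Wc by (intro col_mult2[symmetric, of _ ?N ?N _ ?N]) auto
  finally have col0: "col M 0 = e \<cdot>\<^sub>v unit_vec ?N 0" using W1 by simp
  have Mi0: "M $$ (i, 0) = (if i = 0 then e else 0)" if "i < ?N" for i
    using arg_cong[OF col0, of "\<lambda>u. u $ i"] that Mc by auto
  have M0i: "M $$ (0, i) = (if i = 0 then e else 0)" if "i < ?N" for i
    using hermitian_index[OF hM, of 0 i] hermitian_index[OF hM, of 0 0]
      Mi0[of i] Mi0[of 0] that Mc by auto
  have e: "e = complex_of_real (Re e)"
    using hermitian_index[OF hM, of 0 0] Mi0[of 0] Mc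
    by (auto simp: complex_eq_iff)
  define A3 where "A3 = mat n n (\<lambda>(i,j). M $$ (Suc i, Suc j))"
  have A3: "A3 \<in> carrier_mat n n" by (simp add: A3_def)
  have "hermitian_mat A3"
    unfolding hermitian_mat_def
  proof (rule eq_matI)
    fix i j assume "i < dim_row A3" "j < dim_col A3"
    then show "mat_adjoint A3 $$ (i, j) = A3 $$ (i, j)"
      using hermitian_index[OF hM, of "Suc i" "Suc j"] Mc by (simp add: A3_def)
  qed (use A3 in auto)
  then obtain U d where U: "unitary_mat n U"
    and A3U: "A3 = U * mat_diag n (\<lambda>i. complex_of_real (d i)) * mat_adjoint U"
    using Suc.IH[OF A3] by auto
  have Uc: "U \<in> carrier_mat n n" and U1: "mat_adjoint U * U = 1\<^sub>m n"
    using U by (auto simp: unitary_mat_def)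
  \<comment> \<open>Embedding of the smaller block, with \<open>a\<close> in the corner; it is compatible with products and adjoints.\<close>
  define ext where "ext a X = four_block_mat (mat_diag 1 (\<lambda>_. a)) (0\<^sub>m 1 n) (0\<^sub>m n 1) X"
    for a :: complex and X :: "complex mat"
  have extc: "ext a X \<in> carrier_mat ?N ?N" if "X \<in> carrier_mat n n" for a X
    using that four_block_carrier_mat[of "mat_diag 1 (\<lambda>_. a)" 1 1 X n n] by (simp add: ext_def)
  have ext_mult: "ext a X * ext a' Y = ext (a * a') (X * Y)"
    if "X \<in> carrier_mat n n" "Y \<in> carrier_mat n n" for a a' X Y
    unfolding ext_def using that
    by (subst mult_four_block_mat[of _ 1 1 _ n _ n _ _ 1 _ n])
       (auto simp: right_mult_zero_mat[of _ "Suc 0" "Suc 0"] left_mult_zero_mat[of _ "Suc 0" "Suc 0"])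
  have ext_adj: "mat_adjoint (ext a X) = ext (cnj a) (mat_adjoint X)"
    if "X \<in> carrier_mat n n" for a X
    using that extc[OF that, of a] unfolding ext_def
    by (intro eq_matI) (auto simp: mat_diag_def)
  have ext_diag: "ext (complex_of_real a) (mat_diag n (\<lambda>i. complex_of_real (d i)))
      = mat_diag ?N (\<lambda>i. complex_of_real (case_nat a d i))" for a
    unfolding ext_def by (intro eq_matI) (auto simp: mat_diag_def split: nat.splits)
  have ext_one: "ext 1 (1\<^sub>m n) = 1\<^sub>m ?N"
    unfolding ext_def by (intro eq_matI) (auto simp: mat_diag_def)
  have "M = ext e A3"
    unfolding ext_def using Mc Mi0 M0i
    by (intro eq_matI) (auto simp: mat_diag_def A3_def)
  also have "\<dots> = ext 1 U * ext e (mat_diag n (\<lambda>i. complex_of_real (d i))) * ext 1 (mat_adjoint U)"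
    using Uc by (simp add: ext_mult A3U)
  also have "ext 1 (mat_adjoint U) = mat_adjoint (ext 1 U)" using ext_adj[OF Uc, of 1] by simp
  finally have MU: "M = ext 1 U * mat_diag ?N (\<lambda>i. complex_of_real (case_nat (Re e) d i))
      * mat_adjoint (ext 1 U)"
    using e ext_diag[of "Re e"] by simp
  have eU: "unitary_mat ?N (ext 1 U)"
    using extc[OF Uc] Uc by (intro unitary_matI) (auto simp: ext_adj ext_mult U1 ext_one)
  have "A = (W * ext 1 U) * mat_diag ?N (\<lambda>i. complex_of_real (case_nat (Re e) d i))
      * mat_adjoint (W * ext 1 U)"
    using AM MU Wc extc[OF Uc, of 1]
    by (simp add: mat_adjoint_mult[of _ ?N ?N _ ?N] assoc_mult_mat[of _ ?N ?N _ ?N _ ?N] del: Nat.nat.case)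
  moreover have "unitary_mat ?N (W * ext 1 U)" using unitary_mat_mult[OF W(1) eU] .
  ultimately show ?case by blast
qed

section \<open>Pseudoinverse, trace and quadratic forms\<close>

lemma mat_eqI_vec:
  fixes A B :: "complex mat"
  assumes "A \<in> carrier_mat m n" "B \<in> carrier_mat m n"
    and "\<And>x. x \<in> carrier_vec n \<Longrightarrow> A *\<^sub>v x = B *\<^sub>v x"
  shows "A = B"
proof (rule eq_matI)
  fix i j assume ij: "i < dim_row B" "j < dim_col B"
  have "(A *\<^sub>v unit_vec n j) $ i = (B *\<^sub>v unit_vec n j) $ i"
    using assms(3)[of "unit_vec n j"] by simp
  then show "A $$ (i, j) = B $$ (i, j)" using ij assms(1,2) by simp
qed (use assms in auto)

text \<open>The products \<open>(A * X) * (A * Y)\<close> and \<open>(A * Y) * (A * X)\<close> are adjoint to each other, and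
  collapse to \<open>A * Y\<close> and \<open>A * X\<close>, which are Hermitian. So \<open>A * X = A * Y\<close>, and likewise on the other
  side.\<close>
lemma is_pinv_unique:
  assumes X: "is_pinv A X" and Y: "is_pinv A Y"
  shows "X = Y"
proof -
  obtain m n where A: "A \<in> carrier_mat m n" by blast
  have c: "X \<in> carrier_mat n m" "Y \<in> carrier_mat n m"
    using X Y A by (auto simp: is_pinv_def)
  note ass = assoc_mult_mat[of _ m n _ m _ n] assoc_mult_mat[of _ n m _ n _ m]
    assoc_mult_mat[of _ m n _ m _ m] assoc_mult_mat[of _ m n _ n _ m] assoc_mult_mat[of _ n m _ n _ n]
  have AXA: "A * (X * A) = A" "A * (Y * A) = A" and XAX: "X * (A * X) = X" "Y * (A * Y) = Y"
    using X Y A c by (auto simp: is_pinv_def ass)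
  have h: "mat_adjoint (A * X) = A * X" "mat_adjoint (A * Y) = A * Y"
    "mat_adjoint (X * A) = X * A" "mat_adjoint (Y * A) = Y * A"
    using X Y by (auto simp: is_pinv_def hermitian_mat_def)
  have "(A * Y) * (A * X) = A * (Y * A) * X" "(A * X) * (A * Y) = A * (X * A) * Y"
    using A c by (simp_all add: ass)
  then have "(A * Y) * (A * X) = A * X" "(A * X) * (A * Y) = A * Y" by (simp_all add: AXA)
  then have AX: "A * X = A * Y"
    using mat_adjoint_mult[of "A * Y" m m "A * X" m] A c h by simp
  have "(X * A) * (Y * A) = X * (A * (Y * A))" "(Y * A) * (X * A) = Y * (A * (X * A))"
    using A c by (simp_all add: ass)
  then have "(X * A) * (Y * A) = X * A" "(Y * A) * (X * A) = Y * A" by (simp_all add: AXA)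
  then have XA: "X * A = Y * A"
    using mat_adjoint_mult[of "X * A" n n "Y * A" n] A c h by simp
  have "X = (X * A) * Y" using XAX(1) AX A c by (simp add: ass)
  also have "\<dots> = Y" using XAX(2) XA A c by (simp add: ass)
  finally show ?thesis .
qed

lemma pinv_eqI: "is_pinv A X \<Longrightarrow> pinv A = X"
  unfolding pinv_def by (blast intro: is_pinv_unique)

text \<open>For a unitary \<open>U\<close> whose columns are eigenvectors of a Hermitian matrix with eigenvalues \<open>d\<close>,
  replacing \<open>d\<close> by \<open>\<lambda>i. f (d i)\<close> gives the functional calculus of that matrix. Square roots,
  pseudoinverses and projectors onto ranges are obtained this way.\<close>
definition mat_from_spectrum :: "nat \<Rightarrow> complex mat \<Rightarrow> (nat \<Rightarrow> real) \<Rightarrow> complex mat" where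
  "mat_from_spectrum n U d = U * mat_diag n (\<lambda>i. complex_of_real (d i)) * mat_adjoint U"

lemma hermitian_obtain_spectrum:
  assumes "A \<in> carrier_mat n n" "hermitian_mat A"
  obtains U d where "unitary_mat n U" "A = mat_from_spectrum n U d"
  using spectral_theorem[OF assms] by (auto simp: mat_from_spectrum_def)

lemma mat_trace_mult_commute:
  assumes "A \<in> carrier_mat m n" "B \<in> carrier_mat n m"
  shows "mat_trace (A * B) = mat_trace (B * A)"
proof -
  have "mat_trace (A * B) = (\<Sum>i<m. \<Sum>j<n. A $$ (i,j) * B $$ (j,i))"
    using assms by (auto simp: mat_trace_def scalar_prod_def lessThan_atLeast0)
  also have "\<dots> = (\<Sum>j<n. \<Sum>i<m. A $$ (i,j) * B $$ (j,i))" by (rule sum.swap)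
  also have "\<dots> = mat_trace (B * A)"
    using assms by (auto simp: mat_trace_def scalar_prod_def lessThan_atLeast0 mult.commute)
  finally show ?thesis .
qed

definition sq_norm :: "complex vec \<Rightarrow> real" where
  "sq_norm x = (\<Sum>i<dim_vec x. (cmod (x $ i))\<^sup>2)"

lemma sq_norm_eq: "sq_norm x = Re (x \<bullet>c x)"
  by (simp add: sq_norm_def cscalar_prod_self)

lemma sq_norm_nonneg: "sq_norm x \<ge> 0"
  by (simp add: sq_norm_def sum_nonneg)

lemma sq_norm_eq_0: "x \<in> carrier_vec n \<Longrightarrow> sq_norm x = 0 \<longleftrightarrow> x = 0\<^sub>v n"
  by (auto simp: sq_norm_def sum_nonneg_eq_0_iff)

lemma quad_form_adjoint_mult:
  fixes K :: "complex mat"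
  assumes "K \<in> carrier_mat m n" "x \<in> carrier_vec n"
  shows "quad_form (mat_adjoint K * K) x = sq_norm (K *\<^sub>v x)"
proof -
  have "(mat_adjoint K * K *\<^sub>v x) \<bullet>c x = (mat_adjoint K *\<^sub>v (K *\<^sub>v x)) \<bullet>c x"
    using assms by (simp add: assoc_mult_mat_vec[of _ n m _ n])
  also have "\<dots> = (K *\<^sub>v x) \<bullet>c (K *\<^sub>v x)"
    using assms by (subst cscalar_prod_adjoint[of _ n m]) auto
  finally show ?thesis by (simp add: quad_form_def sq_norm_eq)
qed

lemma adjoint_mult_kernel:
  fixes K :: "complex mat"
  assumes "K \<in> carrier_mat m n" "x \<in> carrier_vec n" "mat_adjoint K * K *\<^sub>v x = 0\<^sub>v n"
  shows "K *\<^sub>v x = 0\<^sub>v m"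
proof -
  have "sq_norm (K *\<^sub>v x) = 0"
    using quad_form_adjoint_mult[OF assms(1,2)] assms by (simp add: quad_form_def)
  then show ?thesis using assms sq_norm_eq_0[of "K *\<^sub>v x" m] by simp
qed

lemma unitary_sq_norm:
  assumes "unitary_mat n U" "x \<in> carrier_vec n"
  shows "sq_norm (U *\<^sub>v x) = sq_norm x"
  using quad_form_adjoint_mult[of U n n x] assms
  by (simp add: unitary_mat_def quad_form_def sq_norm_eq)

section \<open>Functional calculus in a fixed unitary basis\<close>

context
  fixes n :: nat and U :: "complex mat"
  assumes U: "unitary_mat n U"
begin

lemma unitary_facts: "U \<in> carrier_mat n n" "mat_adjoint U * U = 1\<^sub>m n" "U * mat_adjoint U = 1\<^sub>m n"
  using U by (auto simp: unitary_mat_def)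

lemma mat_from_spectrum_carrier [simp]: "mat_from_spectrum n U d \<in> carrier_mat n n"
  using unitary_facts by (simp add: mat_from_spectrum_def)

lemma mat_from_spectrum_mult:
  "mat_from_spectrum n U d * mat_from_spectrum n U d' = mat_from_spectrum n U (\<lambda>i. d i * d' i)"
proof -
  let ?D = "\<lambda>d. mat_diag n (\<lambda>i. complex_of_real (d i))"
  have "mat_from_spectrum n U d * mat_from_spectrum n U d'
     = U * (?D d * (mat_adjoint U * U) * ?D d') * mat_adjoint U"
    using unitary_facts(1) by (simp add: mat_from_spectrum_def assoc_mult_mat[of _ n n _ n _ n])
  then show ?thesis using unitary_facts by (simp add: mat_from_spectrum_def right_mult_one_mat[of _ n n])
qed

lemma mat_from_spectrum_hermitian: "hermitian_mat (mat_from_spectrum n U d)"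
proof -
  have "mat_adjoint (mat_diag n (\<lambda>i. complex_of_real (d i))) = mat_diag n (\<lambda>i. complex_of_real (d i))"
    by (intro eq_matI) (auto simp: mat_diag_def)
  then show ?thesis using unitary_facts(1)
    by (simp add: hermitian_mat_def mat_from_spectrum_def mat_adjoint_mult[of _ n n _ n] assoc_mult_mat[of _ n n _ n _ n])
qed

lemma mat_from_spectrum_trace: "mat_trace (mat_from_spectrum n U d) = complex_of_real (\<Sum>i<n. d i)"
proof -
  have "mat_trace (mat_from_spectrum n U d)
      = mat_trace (mat_adjoint U * (U * mat_diag n (\<lambda>i. complex_of_real (d i))))"
    unfolding mat_from_spectrum_def by (rule mat_trace_mult_commute[of _ n n]) (use unitary_facts in auto)
  also have "mat_adjoint U * (U * mat_diag n (\<lambda>i. complex_of_real (d i))) = mat_diag n (\<lambda>i. complex_of_real (d i))"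
    using unitary_facts by (simp add: left_mult_one_mat[of _ n n] flip: assoc_mult_mat[of _ n n _ n _ n])
  finally show ?thesis by (simp add: mat_trace_def mat_diag_def)
qed

text \<open>As \<open>inverse 0 = 0\<close>, inverting the eigenvalues pointwise leaves the zero eigenvalues alone.\<close>
lemma mat_from_spectrum_pinv: "pinv (mat_from_spectrum n U d) = mat_from_spectrum n U (\<lambda>i. inverse (d i))"
proof (rule pinv_eqI)
  have "(\<lambda>i. d i * inverse (d i) * d i) = d" "(\<lambda>i. inverse (d i) * d i * inverse (d i)) = (\<lambda>i. inverse (d i))"
    by (auto simp: fun_eq_iff field_simps)
  then show "is_pinv (mat_from_spectrum n U d) (mat_from_spectrum n U (\<lambda>i. inverse (d i)))"
    using mat_from_spectrum_carrier[of d]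
    by (simp add: is_pinv_def mat_from_spectrum_mult mat_from_spectrum_hermitian del: mat_from_spectrum_carrier)
       (simp add: carrier_matD[OF mat_from_spectrum_carrier])
qed

lemma mat_from_spectrum_apply:
  assumes x: "x \<in> carrier_vec n"
  shows "mat_from_spectrum n U d *\<^sub>v (U *\<^sub>v x) = U *\<^sub>v vec n (\<lambda>i. complex_of_real (d i) * x $ i)"
proof -
  let ?D = "mat_diag n (\<lambda>i. complex_of_real (d i))"
  have "mat_from_spectrum n U d *\<^sub>v (U *\<^sub>v x) = U *\<^sub>v (?D *\<^sub>v ((mat_adjoint U * U) *\<^sub>v x))"
    using unitary_facts(1) x by (simp add: mat_from_spectrum_def assoc_mult_mat_vec[of _ n n _ n])
  then have "mat_from_spectrum n U d *\<^sub>v (U *\<^sub>v x) = U *\<^sub>v (?D *\<^sub>v x)"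
    using unitary_facts x by simp
  also have "?D *\<^sub>v x = vec n (\<lambda>i. complex_of_real (d i) * x $ i)"
  proof (rule eq_vecI)
    fix i assume "i < dim_vec (vec n (\<lambda>i. complex_of_real (d i) * x $ i))"
    then have i: "i < n" by simp
    have "(?D *\<^sub>v x) $ i = (\<Sum>j = 0..<n. (if i = j then complex_of_real (d j) else 0) * x $ j)"
      using i x by (simp add: mat_diag_def scalar_prod_def)
    also have "\<dots> = (\<Sum>j = 0..<n. if i = j then complex_of_real (d j) * x $ j else 0)"
      by (intro sum.cong) auto
    finally show "(?D *\<^sub>v x) $ i = vec n (\<lambda>i. complex_of_real (d i) * x $ i) $ i"
      using i by simp
  qed (simp add: mat_diag_def)
  finally show ?thesis .
qed

lemma mat_from_spectrum_quad_form:
  assumes x: "x \<in> carrier_vec n"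
  shows "quad_form (mat_from_spectrum n U d) (U *\<^sub>v x) = (\<Sum>i<n. d i * (cmod (x $ i))\<^sup>2)"
proof -
  let ?w = "vec n (\<lambda>i. complex_of_real (d i) * x $ i)"
  have "(U *\<^sub>v ?w) \<bullet>c (U *\<^sub>v x) = ?w \<bullet>c (mat_adjoint U *\<^sub>v (U *\<^sub>v x))"
    using unitary_facts(1) x by (simp add: cscalar_prod_adjoint[of _ n n])
  also have "mat_adjoint U *\<^sub>v (U *\<^sub>v x) = x"
    using unitary_facts x by (simp flip: assoc_mult_mat_vec[of _ n n _ n])
  finally have "quad_form (mat_from_spectrum n U d) (U *\<^sub>v x) = Re (?w \<bullet>c x)"
    using x by (simp add: quad_form_def mat_from_spectrum_apply)
  also have "\<dots> = (\<Sum>i<n. d i * (cmod (x $ i))\<^sup>2)"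
    unfolding cmod_power2 using x
    by (auto simp: scalar_prod_def lessThan_atLeast0 algebra_simps power2_eq_square intro!: sum.cong)
  finally show ?thesis .
qed

lemma mat_from_spectrum_psd_iff:
  "psd_mat n (mat_from_spectrum n U d) \<longleftrightarrow> (\<forall>i<n. d i \<ge> 0)"
proof
  assume p: "psd_mat n (mat_from_spectrum n U d)"
  show "\<forall>i<n. d i \<ge> 0"
  proof (intro allI impI)
    fix i assume i: "i < n"
    have "0 \<le> quad_form (mat_from_spectrum n U d) (U *\<^sub>v unit_vec n i)"
      using p unitary_facts(1) by (auto simp: psd_mat_def)
    also have "\<dots> = (\<Sum>j<n. if j = i then d i else 0)"
      using i by (subst mat_from_spectrum_quad_form) (simp, intro sum.cong, auto)
    finally show "d i \<ge> 0" using i by simp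
  qed
next
  assume d: "\<forall>i<n. d i \<ge> 0"
  have "quad_form (mat_from_spectrum n U d) x \<ge> 0" if x: "x \<in> carrier_vec n" for x
  proof -
    have "U *\<^sub>v (mat_adjoint U *\<^sub>v x) = x"
      using unitary_facts x by (simp flip: assoc_mult_mat_vec[of _ n n _ n])
    then have "quad_form (mat_from_spectrum n U d) x
        = (\<Sum>i<n. d i * (cmod ((mat_adjoint U *\<^sub>v x) $ i))\<^sup>2)"
      using mat_from_spectrum_quad_form[of "mat_adjoint U *\<^sub>v x" d] unitary_facts x by simp
    then show ?thesis using d by (auto intro!: sum_nonneg mult_nonneg_nonneg)
  qed
  then show "psd_mat n (mat_from_spectrum n U d)"
    by (simp add: psd_mat_def mat_from_spectrum_hermitian)
qed

lemma mat_from_spectrum_char_poly: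
  "char_poly (mat_from_spectrum n U d) = (\<Prod>i<n. [:- complex_of_real (d i), 1:])"
proof -
  let ?D = "mat_diag n (\<lambda>i. complex_of_real (d i))"
  have "similar_mat_wit (mat_from_spectrum n U d) ?D U (mat_adjoint U)"
    by (rule similar_mat_witI[of _ _ n])
       (use unitary_facts in \<open>auto simp: mat_from_spectrum_def\<close>)
  then have "similar_mat (mat_from_spectrum n U d) ?D" by (auto simp: similar_mat_def)
  then have "char_poly (mat_from_spectrum n U d) = char_poly ?D" by (rule char_poly_similar)
  also have "\<dots> = (\<Prod>a\<leftarrow>diag_mat ?D. [:- a, 1:])"
    by (rule char_poly_upper_triangular[of _ n]) (auto simp: mat_diag_def)
  also have "diag_mat ?D = map (\<lambda>i. complex_of_real (d i)) [0..<n]"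
    by (auto simp: diag_mat_def mat_diag_def)
  finally show ?thesis
    by (simp add: o_def prod.distinct_set_conv_list[symmetric] lessThan_atLeast0)
qed

end

section \<open>Volume and characteristic polynomial\<close>

lemma order_prod_linear:
  fixes c :: "nat \<Rightarrow> 'a :: field"
  assumes "finite I"
  shows "order a (\<Prod>i\<in>I. [:- c i, 1:]) = card {i \<in> I. c i = a}"
  using assms
proof (induction I rule: finite_induct)
  case (insert j I)
  have nz: "[:- c j, 1:] * (\<Prod>i\<in>I. [:- c i, 1:]) \<noteq> 0"
    using insert.hyps by (intro no_zero_divisors) auto
  have oj: "order a ([:- c j, 1:] * (\<Prod>i\<in>I. [:- c i, 1:]))
      = order a [:- c j, 1:] + order a (\<Prod>i\<in>I. [:- c i, 1:])" by (rule order_mult[OF nz])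
  have *: "{i \<in> insert j I. c i = a} = (if c j = a then insert j {i \<in> I. c i = a} else {i \<in> I. c i = a})"
    by auto
  have "order a [:- c j, 1:] = (if c j = a then 1 else 0)"
    using order_power_n_n[of a 1] by (auto intro: order_0I)
  then show ?case using insert.hyps insert.IH
    unfolding * prod.insert[OF insert.hyps] oj by auto
qed simp

text \<open>Grouping the indices by the value of \<open>d\<close> turns the product over distinct eigenvalues with
  multiplicities into a product over indices. \<open>M\<close> itself may be non-Hermitian: only its
  characteristic polynomial enters.\<close>
lemma mat_vol_real_spectrum:
  assumes M: "M \<in> carrier_mat n n"
    and cp: "char_poly M = (\<Prod>i<n. [:- complex_of_real (d i), 1:])"
    and d: "\<And>i. i < n \<Longrightarrow> d i \<ge> 0"
  shows "mat_vol M = (\<Prod>i | i < n \<and> d i \<noteq> 0. d i)"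
proof -
  let ?I = "{i. i < n \<and> d i \<noteq> 0}"
  have ev: "eigenvalue M (complex_of_real t) \<longleftrightarrow> (\<exists>i<n. d i = t)" for t
    unfolding eigenvalue_root_char_poly[OF M] cp by (auto simp: poly_prod prod_zero_iff)
  have "{t. t > 0 \<and> eigenvalue M (complex_of_real t)} = d ` ?I"
    using d by (force simp: ev)
  moreover have "order (complex_of_real t) (char_poly M) = card {i \<in> ?I. d i = t}" if "t \<in> d ` ?I" for t
    using that unfolding cp
    by (subst order_prod_linear) (auto intro!: arg_cong[where f = card])
  ultimately have "mat_vol M = (\<Prod>t\<in>d ` ?I. t ^ card {i \<in> ?I. d i = t})"
    unfolding mat_vol_def by simp
  also have "\<dots> = (\<Prod>t\<in>d ` ?I. \<Prod>i\<in>{i \<in> ?I. d i = t}. d i)"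
    by (intro prod.cong refl) simp
  also have "\<dots> = (\<Prod>i\<in>?I. d i)"
    by (rule prod.group) auto
  finally show ?thesis .
qed

text \<open>Without inverting a factor: the block matrices \<open>[X Y, 0; Y, 0]\<close> and \<open>[0, 0; Y, Y X]\<close>
  are similar through the unipotent matrix \<open>[1, X; 0, 1]\<close>, and their characteristic polynomials
  are those of \<open>X * Y\<close> and \<open>Y * X\<close> times that of the zero block, which cancels.\<close>
lemma char_poly_mult_commute:
  fixes X Y :: "complex mat"
  assumes X: "X \<in> carrier_mat n n" and Y: "Y \<in> carrier_mat n n"
  shows "char_poly (X * Y) = char_poly (Y * X)"
proof -
  let ?Z = "0\<^sub>m n n :: complex mat" and ?I = "1\<^sub>m n :: complex mat"
  let ?L = "four_block_mat (X * Y) ?Z Y ?Z" and ?R = "four_block_mat ?Z ?Z Y (Y * X)"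
  let ?P = "four_block_mat ?I X ?Z ?I" and ?Q = "four_block_mat ?I (- X) ?Z ?I"
  note mfb = mult_four_block_mat[of _ n n _ n _ n _ _ n _ n]
  have z: "W + - W = ?Z" "- W + W = ?Z" "- ?Z = ?Z" if "W \<in> carrier_mat n n" for W
    using that by (auto intro!: eq_matI)
  have "?P * ?Q = 1\<^sub>m (n + n)" "?Q * ?P = 1\<^sub>m (n + n)"
    using X z by (simp_all add: mfb)
  moreover have "?L = ?P * ?R * ?Q"
    using X Y by (simp add: mfb z assoc_mult_mat[of _ n n _ n _ n])
  ultimately have "similar_mat_wit ?L ?R ?P ?Q"
    using X Y by (intro similar_mat_witI[of _ _ "n + n"]) auto
  then have "similar_mat ?L ?R" by (auto simp: similar_mat_def)
  then have "char_poly ?L = char_poly ?R" by (rule char_poly_similar)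
  moreover have "\<exists>es. char_poly M = (\<Prod>a\<leftarrow>es. [:- a, 1:])" if "M \<in> carrier_mat n n" for M :: "complex mat"
    using char_poly_factorized[OF that] by auto
  then have "char_poly ?L = char_poly (X * Y) * char_poly ?Z" "char_poly ?R = char_poly ?Z * char_poly (Y * X)"
    using X Y by (intro char_poly_0_block'[OF refl, where n = n and m = n]; simp)+
  moreover have "char_poly ?Z \<noteq> 0" using degree_monic_char_poly[of ?Z n] by auto
  ultimately show ?thesis by simp
qed

section \<open>Rank, range, kernel and projectors\<close>

lemma mat_range_mult_subset:
  assumes "A \<in> carrier_mat m n" "B \<in> carrier_mat n l"
  shows "mat_range (A * B) \<subseteq> mat_range A"
proof
  fix y assume "y \<in> mat_range (A * B)"
  then obtain x where x: "x \<in> carrier_vec l" "y = A *\<^sub>v (B *\<^sub>v x)"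
    using assms by (auto simp: mat_range_def assoc_mult_mat_vec[of _ m n _ l])
  then have "B *\<^sub>v x \<in> carrier_vec n" using assms by simp
  then show "y \<in> mat_range A" using x assms by (auto simp: mat_range_def)
qed

lemma mat_rank_eq_of_range_eq:
  assumes A: "A \<in> carrier_mat n k" and B: "B \<in> carrier_mat n l" and r: "mat_range A = mat_range B"
  shows "mat_rank A = mat_rank B"
proof -
  interpret vec_space "TYPE(complex)" n .
  have "mat_range A = col_space A" "mat_range B = col_space B"
    using A B by (auto simp: mat_range_def col_space_eq)
  then have "span (set (cols A)) = span (set (cols B))" using r by (simp add: col_space_def)
  then show ?thesis using A B by (simp add: mat_rank_def rank_def)
qed

lemma mat_rank_orthonormal_cols:
  assumes W: "W \<in> carrier_mat n r" and orth: "mat_adjoint W * W = 1\<^sub>m r"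
  shows "mat_rank W = r"
proof -
  interpret vec_space "TYPE(complex)" n .
  have ent: "(\<Sum>k = 0..<n. cnj (W $$ (k, i)) * W $$ (k, j)) = (if i = j then 1 else 0)"
    if "i < r" "j < r" for i j
    using arg_cong[OF orth, of "\<lambda>M. M $$ (i, j)"] that W by (simp add: scalar_prod_def)
  have "col W i \<noteq> col W j" if ij: "i < r" "j < r" "i \<noteq> j" for i j
  proof
    assume eq: "col W i = col W j"
    have "W $$ (k, i) = W $$ (k, j)" if "k < n" for k
      using arg_cong[OF eq, of "\<lambda>v. v $ k"] that ij W by simp
    then have "(\<Sum>k = 0..<n. cnj (W $$ (k, i)) * W $$ (k, j)) = (\<Sum>k = 0..<n. cnj (W $$ (k, j)) * W $$ (k, j))"
      by (intro sum.cong) auto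
    then show False using ent[of i j] ent[of j j] ij by simp
  qed
  then have dist: "distinct (cols W)" using W by (auto simp: distinct_conv_nth)
  have "\<not> lin_dep (set (cols W))"
  proof
    assume "lin_dep (set (cols W))"
    then obtain v where v: "v \<in> carrier_vec r" "v \<noteq> 0\<^sub>v r" "W *\<^sub>v v = 0\<^sub>v n"
      using lin_depE[OF W _ dist] by blast
    have "v = (mat_adjoint W * W) *\<^sub>v v" using v orth by simp
    also have "\<dots> = mat_adjoint W *\<^sub>v (W *\<^sub>v v)"
      using W v by (intro assoc_mult_mat_vec[of _ r n _ r]) auto
    also have "\<dots> = 0\<^sub>v r" unfolding v(3) using W by (intro eq_vecI) auto
    finally have "v = 0\<^sub>v r" .
    then show False using v by simp
  qed
  then show ?thesis using lin_indpt_full_rank[OF W dist] W by (simp add: mat_rank_def)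
qed

text \<open>The projector \<open>Q\<close> onto the eigenvectors with nonzero eigenvalue has the same range as the
  matrix. It factors as \<open>W * mat_adjoint W\<close>, where the orthonormal columns of \<open>W\<close> are
  those eigenvectors, so all three matrices have the range, and hence the rank, of \<open>W\<close>.\<close>
lemma mat_from_spectrum_rank:
  assumes U: "unitary_mat n U"
  shows "mat_rank (mat_from_spectrum n U d) = card {i. i < n \<and> d i \<noteq> 0}"
proof -
  define js where "js = filter (\<lambda>i. d i \<noteq> 0) [0..<n]"
  define r where "r = length js"
  have Uc: "U \<in> carrier_mat n n" and U1: "mat_adjoint U * U = 1\<^sub>m n"
    using U by (auto simp: unitary_mat_def)
  have dj: "distinct js" and sj: "set js = {i. i < n \<and> d i \<noteq> 0}" by (auto simp: js_def)
  have jn: "js ! k < n" if "k < r" for k using nth_mem[of k js] that sj by (auto simp: r_def)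
  define W where "W = mat n r (\<lambda>(i,k). U $$ (i, js ! k))"
  have Wc: "W \<in> carrier_mat n r" by (simp add: W_def)
  have WW: "mat_adjoint W * W = 1\<^sub>m r"
  proof (rule eq_matI)
    fix k l assume "k < dim_row (1\<^sub>m r :: complex mat)" "l < dim_col (1\<^sub>m r :: complex mat)"
    then have kl: "k < r" "l < r" by auto
    have "(mat_adjoint W * W) $$ (k, l) = (mat_adjoint U * U) $$ (js ! k, js ! l)"
      using kl Uc jn Wc by (simp add: scalar_prod_def W_def)
    then show "(mat_adjoint W * W) $$ (k, l) = 1\<^sub>m r $$ (k, l)"
      using kl jn dj U1 by (simp add: nth_eq_iff_index_eq r_def)
  qed (use Wc in auto)
  let ?M = "mat_from_spectrum n U"
  define Q where "Q = ?M (\<lambda>i. if d i \<noteq> 0 then 1 else 0)"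
  have Qc: "Q \<in> carrier_mat n n" using U by (simp add: Q_def)
  have QW: "Q = W * mat_adjoint W"
  proof (rule eq_matI)
    fix i j assume "i < dim_row (W * mat_adjoint W)" "j < dim_col (W * mat_adjoint W)"
    then have ij: "i < n" "j < n" using Wc by auto
    have "Q $$ (i, j) = (\<Sum>k<n. (if d k \<noteq> 0 then U $$ (i, k) * cnj (U $$ (j, k)) else 0))"
      using ij Uc unfolding Q_def mat_from_spectrum_def
      by (subst mat_diag_mult_right[of _ n]) (auto simp: scalar_prod_def lessThan_atLeast0 intro!: sum.cong)
    also have "\<dots> = (\<Sum>k\<in>set js. U $$ (i, k) * cnj (U $$ (j, k)))"
      unfolding sj by (subst sum.inter_filter[symmetric]) (auto intro!: sum.cong)
    also have "\<dots> = (\<Sum>k<r. U $$ (i, js ! k) * cnj (U $$ (j, js ! k)))"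
      unfolding r_def by (rule sum.reindex_bij_betw[symmetric], rule bij_betw_nth[OF dj]) auto
    also have "\<dots> = (W * mat_adjoint W) $$ (i, j)"
      using ij Wc by (simp add: W_def scalar_prod_def lessThan_atLeast0)
    finally show "Q $$ (i, j) = (W * mat_adjoint W) $$ (i, j)" .
  qed (use Qc Wc in auto)
  have "W = Q * W"
    unfolding QW using Wc WW by (simp add: assoc_mult_mat[of _ n r _ n _ r])
  then have rW: "mat_range W = mat_range Q"
    using mat_range_mult_subset[of Q n n W r] mat_range_mult_subset[of W n r "mat_adjoint W" n] Wc Qc QW
    by auto
  have "(\<lambda>i. (if d i \<noteq> 0 then 1 else 0) * d i) = d" "(\<lambda>i. d i * inverse (d i)) = (\<lambda>i. if d i \<noteq> 0 then 1 else 0)"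
    by auto
  then have "?M d = Q * ?M d" "Q = ?M d * ?M (\<lambda>i. inverse (d i))"
    using U by (simp_all add: Q_def mat_from_spectrum_mult)
  then have "mat_range (?M d) = mat_range Q"
    using mat_range_mult_subset[of Q n n "?M d" n] mat_range_mult_subset[of "?M d" n n "?M (\<lambda>i. inverse (d i))" n]
      Qc mat_from_spectrum_carrier[OF U] by auto
  then have "mat_rank (?M d) = mat_rank W"
    using rW mat_from_spectrum_carrier[OF U] Wc by (intro mat_rank_eq_of_range_eq[of _ n n _ r]) auto
  also have "\<dots> = card (set js)"
    using mat_rank_orthonormal_cols[OF Wc WW] distinct_card[OF dj] by (simp add: r_def)
  finally show ?thesis by (simp add: sj)
qed

text \<open>Everything is read off the eigenvalues. Commutation of \<open>A\<close> with its pseudoinverse, which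
  fails for general matrices, makes \<open>A * pinv A\<close> the projector onto the range and also the projector
  along the kernel.\<close>
lemma pinv_hermitian:
  assumes "A \<in> carrier_mat n n" "hermitian_mat A"
  shows "pinv A \<in> carrier_mat n n" "hermitian_mat (pinv A)" "pinv A * A = A * pinv A"
    "A * (pinv A * A) = A" "pinv A * (A * pinv A) = pinv A" "hermitian_mat (A * pinv A)"
proof -
  obtain U d where U: "unitary_mat n U" and A: "A = mat_from_spectrum n U d"
    using hermitian_obtain_spectrum[OF assms] .
  have *: "(\<lambda>i. d i * (inverse (d i) * d i)) = d" "(\<lambda>i. inverse (d i) * (d i * inverse (d i))) = (\<lambda>i. inverse (d i))"
    by (auto simp: fun_eq_iff field_simps)
  show "pinv A \<in> carrier_mat n n" "hermitian_mat (pinv A)" "pinv A * A = A * pinv A"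
    "A * (pinv A * A) = A" "pinv A * (A * pinv A) = pinv A" "hermitian_mat (A * pinv A)"
    using U * by (simp_all add: A mat_from_spectrum_pinv mat_from_spectrum_mult mat_from_spectrum_hermitian mult.commute)
qed

lemma pinv_psd:
  assumes "psd_mat n A"
  shows "psd_mat n (pinv A)"
proof -
  obtain U d where U: "unitary_mat n U" and A: "A = mat_from_spectrum n U d"
    using hermitian_obtain_spectrum[of A n] assms by (auto simp: psd_mat_def)
  then show ?thesis using assms by (simp add: mat_from_spectrum_pinv mat_from_spectrum_psd_iff)
qed

lemma psd_obtain_sqrt:
  assumes "psd_mat n A"
  obtains C where "C \<in> carrier_mat n n" "hermitian_mat C" "C * C = A"
proof -
  obtain U d where U: "unitary_mat n U" and A: "A = mat_from_spectrum n U d"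
    using hermitian_obtain_spectrum[of A n] assms by (auto simp: psd_mat_def)
  have d: "\<And>i. i < n \<Longrightarrow> d i \<ge> 0" using assms U A by (simp add: mat_from_spectrum_psd_iff)
  have "mat_diag n (\<lambda>i. complex_of_real (sqrt (d i) * sqrt (d i))) = mat_diag n (\<lambda>i. complex_of_real (d i))"
    using d by (intro eq_matI) (auto simp: mat_diag_def simp flip: of_real_mult)
  then have "mat_from_spectrum n U (\<lambda>i. sqrt (d i)) * mat_from_spectrum n U (\<lambda>i. sqrt (d i)) = A"
    unfolding A mat_from_spectrum_mult[OF U] by (simp only: mat_from_spectrum_def)
  then show thesis using that U mat_from_spectrum_hermitian mat_from_spectrum_carrier by blast
qed

lemma hermitian_projector_absorb:
  assumes A: "A \<in> carrier_mat n n" "hermitian_mat A" and B: "B \<in> carrier_mat n m"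
    and r: "mat_range B \<subseteq> mat_range A"
  shows "(A * pinv A) * B = B"
proof (rule mat_eqI_vec)
  note X = pinv_hermitian[OF A]
  fix x :: "complex vec" assume x: "x \<in> carrier_vec m"
  then have "B *\<^sub>v x \<in> mat_range A" using r B by (auto simp: mat_range_def)
  then obtain y where y: "y \<in> carrier_vec n" "B *\<^sub>v x = A *\<^sub>v y"
    using A by (auto simp: mat_range_def)
  have "(A * pinv A) * B *\<^sub>v x = (A * pinv A) *\<^sub>v (A *\<^sub>v y)"
    using A(1) B X(1) x by (simp add: assoc_mult_mat_vec[of _ n n _ m] flip: y(2))
  also have "\<dots> = (A * (pinv A * A)) *\<^sub>v y"
    using A X(1) y(1) by (simp add: assoc_mult_mat_vec[of _ n n _ n])
  finally show "(A * pinv A) * B *\<^sub>v x = B *\<^sub>v x" using X y by simp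
qed (use assms pinv_hermitian[OF A] in auto)

text \<open>A Hermitian matrix has as range the orthogonal complement of its kernel, so the inclusion
  of kernels is reversed. Algebraically: \<open>B\<close> vanishes on the kernel of \<open>A\<close>, so
  \<open>B * (A * pinv A) = B\<close>, and the adjoint of this identity puts the range of \<open>B\<close> inside that of \<open>A\<close>.\<close>
lemma hermitian_range_subset_of_kernel_subset:
  assumes A: "A \<in> carrier_mat n n" "hermitian_mat A" and B: "B \<in> carrier_mat n n" "hermitian_mat B"
    and ker: "\<And>x. x \<in> carrier_vec n \<Longrightarrow> A *\<^sub>v x = 0\<^sub>v n \<Longrightarrow> B *\<^sub>v x = 0\<^sub>v n"
  shows "mat_range B \<subseteq> mat_range A"
proof -
  note X = pinv_hermitian[OF A]
  have "B * (A * pinv A) = B"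
  proof (rule mat_eqI_vec)
    fix x :: "complex vec" assume x: "x \<in> carrier_vec n"
    define z where "z = x - (A * pinv A) *\<^sub>v x"
    have zc: "z \<in> carrier_vec n" using x A X(1) by (simp add: z_def)
    have "A *\<^sub>v z = A *\<^sub>v x - (A * (A * pinv A)) *\<^sub>v x"
      using x A X(1) unfolding z_def
      by (subst mult_minus_distrib_mat_vec[of _ n n]) (simp_all add: assoc_mult_mat_vec[of _ n n _ n])
    also have "A * (A * pinv A) = A" using X(3,4) by simp
    finally have "A *\<^sub>v z = 0\<^sub>v n" using A x by simp
    then have "B *\<^sub>v z = 0\<^sub>v n" using ker zc by simp
    then have diff: "B *\<^sub>v x - (B * (A * pinv A)) *\<^sub>v x = 0\<^sub>v n"
      using x A X(1) B unfolding z_def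
      by (subst (asm) mult_minus_distrib_mat_vec[of _ n n]) (simp_all add: assoc_mult_mat_vec[of _ n n _ n])
    show "B * (A * pinv A) *\<^sub>v x = B *\<^sub>v x"
    proof (rule eq_vecI)
      fix i assume "i < dim_vec (B *\<^sub>v x)"
      then show "(B * (A * pinv A) *\<^sub>v x) $ i = (B *\<^sub>v x) $ i"
        using arg_cong[OF diff, of "\<lambda>v. v $ i"] B
        by (simp del: index_mult_mat_vec)
    qed (use B in simp)
  qed (use A B X in auto)
  from arg_cong[OF this, of mat_adjoint]
  have "(A * pinv A) * B = B"
    using A B X by (simp add: mat_adjoint_mult[of _ n n _ n] hermitian_mat_def)
  then have "A * (pinv A * B) = B" using A B X by (simp add: assoc_mult_mat[of _ n n _ n _ n])
  then show ?thesis using mat_range_mult_subset[of A n n "pinv A * B" n] A B X by simp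
qed

text \<open>Each projector absorbs the other from the left, and the two absorption identities are
  adjoint to each other.\<close>
lemma hermitian_projector_eq_of_range_eq:
  assumes A: "A \<in> carrier_mat n n" "hermitian_mat A" and B: "B \<in> carrier_mat n n" "hermitian_mat B"
    and r: "mat_range A = mat_range B"
  shows "A * pinv A = B * pinv B"
proof -
  note X = pinv_hermitian[OF A] and Y = pinv_hermitian[OF B]
  let ?P = "A * pinv A" and ?Q = "B * pinv B"
  have PQ: "?P * ?Q = ?Q"
    by (rule hermitian_projector_absorb[OF A])
       (use mat_range_mult_subset[OF B(1) Y(1)] r B Y(1) in auto)
  have QP: "?Q * ?P = ?P"
    by (rule hermitian_projector_absorb[OF B])
       (use mat_range_mult_subset[OF A(1) X(1)] r A X(1) in auto)
  have "mat_adjoint (?P * ?Q) = mat_adjoint ?Q * mat_adjoint ?P"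
    using A(1) B(1) X(1) Y(1) by (intro mat_adjoint_mult[of _ n n _ n]) auto
  then show ?thesis using PQ QP X(6) Y(6) by (simp add: hermitian_mat_def)
qed

section \<open>The symmetrized preconditioned matrix\<close>

lemma hermitian_square_kernel:
  assumes "C \<in> carrier_mat n n" "hermitian_mat C" "x \<in> carrier_vec n" "C * C *\<^sub>v x = 0\<^sub>v n"
  shows "C *\<^sub>v x = 0\<^sub>v n"
  using adjoint_mult_kernel[of C n n x] assms by (simp add: hermitian_mat_def)

lemma congruence_eq_gram:
  assumes C: "C \<in> carrier_mat n n" "hermitian_mat C" and K: "K \<in> carrier_mat n n" "hermitian_mat K"
  shows "C * (K * K * C) = mat_adjoint (K * C) * (K * C)"
  using C K by (simp add: mat_adjoint_mult[of _ n n _ n] hermitian_mat_def assoc_mult_mat[of _ n n _ n _ n])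

text \<open>With a square root \<open>K\<close> of \<open>pinv A'\<close> the matrix \<open>H\<close> is the Gram matrix of \<open>K * C\<close>, so
  \<open>H *\<^sub>v x = 0\<close> forces \<open>pinv A' *\<^sub>v (C *\<^sub>v x) = 0\<close>. But \<open>C *\<^sub>v x\<close> lies in the common range of \<open>A\<close> and
  \<open>A'\<close>, on which \<open>pinv A'\<close> is injective, so \<open>C *\<^sub>v x = 0\<close>. Hence \<open>H\<close> and \<open>C\<close> have the same kernel,
  and therefore the same range, which is also that of \<open>A = C * C\<close>.\<close>
lemma symmetrized_product:
  assumes A: "psd_mat n A" and A': "psd_mat n A'" and r: "mat_range A = mat_range A'"
    and C: "C \<in> carrier_mat n n" "hermitian_mat C" "C * C = A"
  defines "H \<equiv> C * (pinv A' * C)"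
  shows "psd_mat n H" "mat_range H = mat_range A" "mat_range C \<subseteq> mat_range H"
proof -
  have Ac: "A \<in> carrier_mat n n" "hermitian_mat A" and A'c: "A' \<in> carrier_mat n n" "hermitian_mat A'"
    using A A' by (auto simp: psd_mat_def)
  note X = pinv_hermitian[OF Ac] and Y = pinv_hermitian[OF A'c]
  obtain K where K: "K \<in> carrier_mat n n" "hermitian_mat K" "K * K = pinv A'"
    using psd_obtain_sqrt[OF pinv_psd[OF A']] .
  have H: "H = mat_adjoint (K * C) * (K * C)"
    unfolding H_def K(3)[symmetric] by (rule congruence_eq_gram[OF C(1,2) K(1,2)])
  have Hc: "H \<in> carrier_mat n n" using C Y by (simp add: H_def)
  have hH: "hermitian_mat H"
    unfolding hermitian_mat_def H using C(1) K(1)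
    by (simp add: mat_adjoint_mult[of "mat_adjoint (K * C)" n n _ n])
  show psd: "psd_mat n H"
    unfolding psd_mat_def using Hc hH C(1) K(1)
    by (simp add: H quad_form_adjoint_mult[of "K * C" n n] sq_norm_nonneg)
  have "A *\<^sub>v x = 0\<^sub>v n \<Longrightarrow> C *\<^sub>v x = 0\<^sub>v n" if "x \<in> carrier_vec n" for x
    using hermitian_square_kernel[OF C(1,2) that] C(3) by simp
  then have CA: "mat_range C \<subseteq> mat_range A"
    by (rule hermitian_range_subset_of_kernel_subset[OF Ac C(1,2)])
  have "C *\<^sub>v x = 0\<^sub>v n" if x: "x \<in> carrier_vec n" and Hx: "H *\<^sub>v x = 0\<^sub>v n" for x
  proof -
    have "K * C *\<^sub>v x = 0\<^sub>v n"
      using adjoint_mult_kernel[of "K * C" n n x] x Hx C K by (simp add: H)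
    then have "K *\<^sub>v (C *\<^sub>v x) = 0\<^sub>v n"
      using x C K by (simp add: assoc_mult_mat_vec[of _ n n _ n])
    then have "pinv A' *\<^sub>v (C *\<^sub>v x) = K *\<^sub>v 0\<^sub>v n"
      using x C K by (simp add: assoc_mult_mat_vec[of _ n n _ n] flip: K(3))
    also have "\<dots> = 0\<^sub>v n" using K by (intro eq_vecI) auto
    finally have z: "pinv A' *\<^sub>v (C *\<^sub>v x) = 0\<^sub>v n" .
    have "C *\<^sub>v x = (A' * pinv A' * C) *\<^sub>v x"
      using hermitian_projector_absorb[OF A'c C(1)] CA r by simp
    also have "\<dots> = A' *\<^sub>v (pinv A' *\<^sub>v (C *\<^sub>v x))"
      using x C A'c Y(1) by (simp add: assoc_mult_mat_vec[of _ n n _ n])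
    also have "\<dots> = 0\<^sub>v n" unfolding z using A'c by (intro eq_vecI) auto
    finally show ?thesis .
  qed
  then show CH: "mat_range C \<subseteq> mat_range H"
    by (rule hermitian_range_subset_of_kernel_subset[OF Hc hH C(1,2)])
  have "mat_range H \<subseteq> mat_range C"
    unfolding H_def using C Y by (intro mat_range_mult_subset[of _ n n _ n]) auto
  moreover have "mat_range A \<subseteq> mat_range C"
    using mat_range_mult_subset[of C n n C n] C by simp
  ultimately show "mat_range H = mat_range A" using CA CH by blast
qed

lemma one_minus_spectrum_sq_norm:
  assumes U: "unitary_mat n U" and x: "x \<in> carrier_vec n"
  shows "sq_norm (U *\<^sub>v x - mat_from_spectrum n U d *\<^sub>v (U *\<^sub>v x)) = (\<Sum>i<n. (1 - d i)\<^sup>2 * (cmod (x $ i))\<^sup>2)"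
proof -
  let ?w = "vec n (\<lambda>i. complex_of_real (1 - d i) * x $ i)"
  have Uc: "U \<in> carrier_mat n n" using U by (simp add: unitary_mat_def)
  have "U *\<^sub>v x - mat_from_spectrum n U d *\<^sub>v (U *\<^sub>v x) = U *\<^sub>v (x - vec n (\<lambda>i. complex_of_real (d i) * x $ i))"
    using Uc x by (simp add: mat_from_spectrum_apply[OF U] mult_minus_distrib_mat_vec[of _ n n])
  also have "x - vec n (\<lambda>i. complex_of_real (d i) * x $ i) = ?w"
    using x by (intro eq_vecI) (auto simp: algebra_simps)
  finally have "sq_norm (U *\<^sub>v x - mat_from_spectrum n U d *\<^sub>v (U *\<^sub>v x)) = sq_norm ?w"
    using unitary_sq_norm[OF U, of ?w] by simp
  also have "\<dots> = (\<Sum>i<n. (1 - d i)\<^sup>2 * (cmod (x $ i))\<^sup>2)"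
    by (simp add: sq_norm_def norm_mult power_mult_distrib del: of_real_diff)
  finally show ?thesis .
qed

text \<open>This is what confines the step to the nonzero eigenvalues: a zero eigenvalue would contribute
  the factor \<open>(1 - 0)\<^sup>2 = 1\<close>, which no gap controls.\<close>
lemma range_coefficient_zero:
  assumes U: "unitary_mat n U" and x: "x \<in> carrier_vec n"
    and r: "U *\<^sub>v x \<in> mat_range (mat_from_spectrum n U d)"
    and i: "i < n" "d i = 0"
  shows "x $ i = 0"
proof -
  have Uc: "U \<in> carrier_mat n n" "mat_adjoint U * U = 1\<^sub>m n" "U * mat_adjoint U = 1\<^sub>m n"
    using U by (auto simp: unitary_mat_def)
  have inv: "mat_adjoint U *\<^sub>v (U *\<^sub>v y) = y" if "y \<in> carrier_vec n" for y
    using Uc that by (simp flip: assoc_mult_mat_vec[of _ n n _ n])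
  obtain y where y: "y \<in> carrier_vec n" "U *\<^sub>v x = mat_from_spectrum n U d *\<^sub>v y"
    using r carrier_matD[OF mat_from_spectrum_carrier[OF U]] by (auto simp: mat_range_def)
  define z where "z = mat_adjoint U *\<^sub>v y"
  have z: "z \<in> carrier_vec n" "y = U *\<^sub>v z"
    using Uc y by (simp_all add: z_def flip: assoc_mult_mat_vec[of _ n n _ n])
  let ?w = "vec n (\<lambda>i. complex_of_real (d i) * z $ i)"
  have "U *\<^sub>v x = U *\<^sub>v ?w" using y(2) z mat_from_spectrum_apply[OF U z(1)] by simp
  then have "mat_adjoint U *\<^sub>v (U *\<^sub>v x) = mat_adjoint U *\<^sub>v (U *\<^sub>v ?w)" by (rule arg_cong)
  then have "x = ?w" by (simp only: inv[OF x] inv[OF vec_carrier])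
  then have "x $ i = ?w $ i" by (rule arg_cong)
  then show ?thesis using i by simp
qed

lemma norm_mat_sq:
  assumes A: "psd_mat n A" and C: "C \<in> carrier_mat n n" "hermitian_mat C" "C * C = A"
    and x: "x \<in> carrier_vec n"
  shows "(norm_mat A x)\<^sup>2 = sq_norm (C *\<^sub>v x)"
  using quad_form_adjoint_mult[OF C(1) x] C sq_norm_nonneg[of "C *\<^sub>v x"]
  by (simp add: norm_mat_def hermitian_mat_def)

section \<open>One step of the preconditioned iteration\<close>

text \<open>Equality of ranges gives \<open>pinv A' * (A * pinv A) = pinv A'\<close>. So \<open>pinv A'\<close> does not see the part
  of \<open>b\<close> outside the range of \<open>A\<close>, and \<open>b\<close> may be replaced by \<open>A *\<^sub>v (pinv A *\<^sub>v b)\<close>.\<close>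
lemma step_error:
  assumes A: "A \<in> carrier_mat n n" "hermitian_mat A" and A': "A' \<in> carrier_mat n n" "hermitian_mat A'"
    and r: "mat_range A = mat_range A'"
    and b: "b \<in> carrier_vec n" and x0: "x0 \<in> carrier_vec n"
  shows "x0 + pinv A' *\<^sub>v (b - A *\<^sub>v x0) - pinv A *\<^sub>v b
    = (x0 - pinv A *\<^sub>v b) - pinv A' *\<^sub>v (A *\<^sub>v (x0 - pinv A *\<^sub>v b))"
proof -
  note X = pinv_hermitian[OF A] and Y = pinv_hermitian[OF A']
  let ?xs = "pinv A *\<^sub>v b"
  have "pinv A' *\<^sub>v (A *\<^sub>v ?xs) = (pinv A' * (A * pinv A)) *\<^sub>v b"
    using A(1) X(1) Y(1) b by (simp add: assoc_mult_mat_vec[of _ n n _ n])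
  also have "pinv A' * (A * pinv A) = pinv A'"
    unfolding hermitian_projector_eq_of_range_eq[OF A A' r] by (rule Y(5))
  finally have "pinv A' *\<^sub>v (A *\<^sub>v ?xs) = pinv A' *\<^sub>v b" .
  moreover have "pinv A' *\<^sub>v (A *\<^sub>v (x0 - ?xs)) = pinv A' *\<^sub>v (A *\<^sub>v x0) - pinv A' *\<^sub>v (A *\<^sub>v ?xs)"
    "pinv A' *\<^sub>v (b - A *\<^sub>v x0) = pinv A' *\<^sub>v b - pinv A' *\<^sub>v (A *\<^sub>v x0)"
    using A X(1) Y(1) b x0 by (simp_all add: mult_minus_distrib_mat_vec[of _ n n])
  moreover have "p + (q - s) - t = (p - t) - (s - q)"
    if "p \<in> carrier_vec n" "q \<in> carrier_vec n" "s \<in> carrier_vec n" "t \<in> carrier_vec n"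
    for p q s t :: "complex vec"
    using that by (intro eq_vecI) auto
  ultimately show ?thesis using A X(1) Y(1) b x0 by simp
qed

text \<open>Rank zero would turn an infinite right-hand side into \<open>0 * \<infinity> = 0\<close>. Positive rank also gives
  \<open>1 / r * r = 1\<close> in the normalized Kaporin number.\<close>
lemma rank_pos_of_norm_nonzero:
  assumes A: "psd_mat n A" and x: "x \<in> carrier_vec n" and nz: "norm_mat A x \<noteq> 0"
  shows "mat_rank A > 0"
proof -
  obtain U d where U: "unitary_mat n U" and Ad: "A = mat_from_spectrum n U d"
    using hermitian_obtain_spectrum[of A n] A by (auto simp: psd_mat_def)
  have "U *\<^sub>v (mat_adjoint U *\<^sub>v x) = x"
    using U x by (simp add: unitary_mat_def flip: assoc_mult_mat_vec[of _ n n _ n])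
  then have "quad_form A x = (\<Sum>i<n. d i * (cmod ((mat_adjoint U *\<^sub>v x) $ i))\<^sup>2)"
    using mat_from_spectrum_quad_form[OF U, of "mat_adjoint U *\<^sub>v x" d] U x
    by (simp add: Ad unitary_mat_def)
  moreover have "quad_form A x \<noteq> 0" using nz by (auto simp: norm_mat_def)
  ultimately have "(\<Sum>i<n. d i * (cmod ((mat_adjoint U *\<^sub>v x) $ i))\<^sup>2) \<noteq> 0" by simp
  then obtain i where "i \<in> {..<n}" "d i * (cmod ((mat_adjoint U *\<^sub>v x) $ i))\<^sup>2 \<noteq> 0"
    by (rule sum.not_neutral_contains_not_neutral)
  then have "\<exists>i<n. d i \<noteq> 0" by auto
  then show ?thesis by (auto simp: Ad mat_from_spectrum_rank[OF U] card_gt_0_iff)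
qed

text \<open>In the eigenbasis of \<open>H\<close> the step multiplies the \<open>i\<close>-th coefficient of \<open>C *\<^sub>v e\<close> by
  \<open>1 - t i\<close>, and only the coefficients with \<open>t i \<noteq> 0\<close> occur. Trace and volume of
  \<open>A * pinv A' = C * (C * pinv A')\<close> are expressed through the same \<open>t i\<close> because
  \<open>H = (C * pinv A') * C\<close> differs by the order of the factors, and the rank of \<open>A\<close> because
  \<open>A\<close> and \<open>H\<close> have the same range.\<close>
lemma kaporin_step_bound:
  assumes A: "psd_mat n A" and A': "psd_mat n A'" and r: "mat_range A = mat_range A'"
    and tr: "mat_trace (A * pinv A') = of_nat (mat_rank A)"
    and e: "e \<in> carrier_vec n"
  shows "(norm_mat A (e - pinv A' *\<^sub>v (A *\<^sub>v e)))\<^sup>2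
      \<le> 2 * real (mat_rank A) * - ln (mat_vol (A * pinv A')) * (norm_mat A e)\<^sup>2"
    and "mat_vol (A * pinv A') > 0"
proof -
  let ?B = "pinv A'"
  have Ac: "A \<in> carrier_mat n n" and A'c: "A' \<in> carrier_mat n n" "hermitian_mat A'"
    using A A' by (auto simp: psd_mat_def)
  note B = pinv_hermitian(1)[OF A'c]
  obtain C where C: "C \<in> carrier_mat n n" "hermitian_mat C" "C * C = A"
    using psd_obtain_sqrt[OF A] .
  define H where "H = C * (?B * C)"
  note sym = symmetrized_product[OF A A' r C, folded H_def]
  have Hc: "H \<in> carrier_mat n n" "hermitian_mat H" using sym(1) by (auto simp: psd_mat_def)
  obtain V t where V: "unitary_mat n V" and Ht: "H = mat_from_spectrum n V t"
    using hermitian_obtain_spectrum[OF Hc] .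
  have Vc: "V \<in> carrier_mat n n" "mat_adjoint V \<in> carrier_mat n n" using V by (auto simp: unitary_mat_def)
  have t0: "t i \<ge> 0" if "i < n" for i
    using sym(1) that by (simp add: Ht mat_from_spectrum_psd_iff[OF V])
  define I where "I = {i. i < n \<and> t i \<noteq> 0}"
  have I: "finite I" "\<And>i. i \<in> I \<Longrightarrow> t i > 0" using t0 by (auto simp: I_def less_le)
  have "mat_rank A = mat_rank H"
    using mat_rank_eq_of_range_eq[OF Ac Hc(1)] sym(2) by simp
  then have rank: "mat_rank A = card I" by (simp add: Ht mat_from_spectrum_rank[OF V] I_def)
  have AB: "A * ?B = C * (C * ?B)" and HC: "H = (C * ?B) * C"
    using C(1) B by (simp_all add: H_def assoc_mult_mat[of _ n n _ n _ n] flip: C(3))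
  have "mat_trace (A * ?B) = mat_trace H"
    unfolding AB HC by (rule mat_trace_mult_commute[of _ n n]) (use C(1) B in auto)
  also have "\<dots> = complex_of_real (\<Sum>i<n. t i)" by (simp add: Ht mat_from_spectrum_trace[OF V])
  also have "(\<Sum>i<n. t i) = sum t I" by (rule sum.mono_neutral_right) (auto simp: I_def)
  finally have "complex_of_real (sum t I) = complex_of_real (real (card I))" using tr rank by simp
  then have sum: "sum t I = real (card I)" by (simp only: of_real_eq_iff)
  have "char_poly (A * ?B) = char_poly H"
    unfolding AB HC by (rule char_poly_mult_commute) (use C(1) B in auto)
  then have vol: "mat_vol (A * ?B) = prod t I"
    using mat_vol_real_spectrum[of "A * ?B" n t] Ac B t0
    by (simp add: I_def Ht mat_from_spectrum_char_poly[OF V])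
  show "mat_vol (A * ?B) > 0" unfolding vol using I by (intro prod_pos) auto
  define y where "y = C *\<^sub>v e"
  have y: "y \<in> carrier_vec n" using C e by (simp add: y_def)
  define z where "z = mat_adjoint V *\<^sub>v y"
  have z: "z \<in> carrier_vec n" "y = V *\<^sub>v z"
    using V y by (simp_all add: z_def unitary_mat_def flip: assoc_mult_mat_vec[of _ n n _ n])
  have "y \<in> mat_range H" using sym(3) C e by (auto simp: y_def mat_range_def)
  then have z0: "z $ i = 0" if "i < n" "t i = 0" for i
    using range_coefficient_zero[OF V z(1)] that z(2) Ht by simp
  have "C *\<^sub>v (e - ?B *\<^sub>v (A *\<^sub>v e)) = y - H *\<^sub>v y"
    using C(1) B e
    by (simp add: y_def H_def mult_minus_distrib_mat_vec[of _ n n] assoc_mult_mat_vec[of _ n n _ n] flip: C(3))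
  moreover have "e - ?B *\<^sub>v (A *\<^sub>v e) \<in> carrier_vec n" using e B Ac by simp
  ultimately have "(norm_mat A (e - ?B *\<^sub>v (A *\<^sub>v e)))\<^sup>2 = sq_norm (y - H *\<^sub>v y)"
    using norm_mat_sq[OF A C] by simp
  also have "\<dots> = (\<Sum>i<n. (1 - t i)\<^sup>2 * (cmod (z $ i))\<^sup>2)"
    unfolding z(2) Ht by (rule one_minus_spectrum_sq_norm[OF V z(1)])
  also have "\<dots> \<le> (\<Sum>i<n. 2 * real (card I) * - ln (prod t I) * (cmod (z $ i))\<^sup>2)"
  proof (rule sum_mono)
    fix i assume i: "i \<in> {..<n}"
    show "(1 - t i)\<^sup>2 * (cmod (z $ i))\<^sup>2 \<le> 2 * real (card I) * - ln (prod t I) * (cmod (z $ i))\<^sup>2"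
    proof (cases "t i = 0")
      case False
      then have "i \<in> I" using i by (simp add: I_def)
      then have "(1 - t i)\<^sup>2 \<le> 2 * real (card I) * - ln (prod t I)"
        by (intro square_deviation_le_ln_prod I sum)
      then show ?thesis by (rule mult_right_mono) simp
    qed (use i z0 in simp)
  qed
  also have "\<dots> = 2 * real (card I) * - ln (prod t I) * sq_norm z"
    using z(1) by (simp add: sq_norm_def sum_distrib_left sum_negf mult.assoc)
  also have "sq_norm z = (norm_mat A e)\<^sup>2"
    using unitary_sq_norm[OF V z(1)] z(2) norm_mat_sq[OF A C e] by (simp add: y_def)
  finally show "(norm_mat A (e - ?B *\<^sub>v (A *\<^sub>v e)))\<^sup>2
      \<le> 2 * real (mat_rank A) * - ln (mat_vol (A * ?B)) * (norm_mat A e)\<^sup>2"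
    by (simp only: rank vol)
qed

theorem proposition3p2:
  fixes n :: nat and A A' :: "complex mat" and b x0 xs x' :: "complex vec"
  assumes "psd_mat n A" and "psd_mat n A'"
    and "b \<in> carrier_vec n" and "x0 \<in> carrier_vec n"
    and "xs = pinv A *\<^sub>v b"
    and "norm_mat A (x0 - xs) \<noteq> 0"
    and "mat_trace (A * pinv A') = of_nat (mat_rank A)"
    and "x' = x0 + pinv A' *\<^sub>v (b - A *\<^sub>v x0)"
  shows "ereal ((norm_mat A (x' - xs))\<^sup>2 / (norm_mat A (x0 - xs))\<^sup>2)
           \<le> ereal (2 * real (mat_rank A)) * ln_ereal (kaporin A A')"
proof -
  note A = assms(1) and A' = assms(2) and b = assms(3) and x0 = assms(4)
  have Ac: "A \<in> carrier_mat n n" "hermitian_mat A" and A'c: "A' \<in> carrier_mat n n" "hermitian_mat A'"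
    using A A' by (auto simp: psd_mat_def)
  define e where "e = x0 - xs"
  have e: "e \<in> carrier_vec n" using assms(5) pinv_hermitian(1)[OF Ac] b x0 by (simp add: e_def)
  have rank: "mat_rank A > 0" using rank_pos_of_norm_nonzero[OF A e] assms(6) by (simp add: e_def)
  show ?thesis
  proof (cases "mat_range A = mat_range A'")
    case False
    then show ?thesis using rank by (simp add: kaporin_def ln_ereal_def)
  next
    case True
    let ?v = "mat_vol (A * pinv A')"
    note bound = kaporin_step_bound[OF A A' True assms(7) e]
    have "x' - xs = e - pinv A' *\<^sub>v (A *\<^sub>v e)"
      using step_error[OF Ac A'c True b x0] by (simp add: e_def assms(5,8))
    moreover have "(norm_mat A e)\<^sup>2 > 0" using assms(6) by (simp add: e_def)
    ultimately have *: "(norm_mat A (x' - xs))\<^sup>2 / (norm_mat A (x0 - xs))\<^sup>2 \<le> 2 * real (mat_rank A) * - ln ?v"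
      using bound(1) by (simp add: divide_le_eq flip: e_def)
    have "kaporin A A' = ereal (1 / ?v)"
      using True rank assms(7) by (simp add: kaporin_def)
    then have "ln_ereal (kaporin A A') = ereal (- ln ?v)"
      using bound(2) by (simp add: ln_ereal_def ln_div)
    then show ?thesis using * by simp
  qed
qed

end
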